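(* Let $U\subset(\mathbb{C}^* )^3$ be a connected open set with coordinates $\boldsymbol{t}=(t_0,t_1,t_2)$. Let $s_0,s_1,s_2\colon U\to\mathbb{C}^*$ be holomorphic functions with $$t_i^2=s_i^3\qquad (i=0,1,2),$$ and let $q_1,q_2,q_3\colon U\to\mathbb{C}$ be holomorphic functions such that, at every point of $U$, $q_1,q_2,q_3$ are pairwise distinct, none of them is $0$ or $1$, and they are the three roots of the cubic equation $$q_j^3+\frac{s_0-s_1-3s_2}{2s_2}\,q_j^2+\frac{-3s_0-s_1+s_2}{2s_2}\,q_j+\frac{s_0}{s_2}=0\qquad (j=1,2,3).$$ Define $$\eta_j=\frac{1}{3q_j}+\frac{1}{3(q_j-1)}\qquad (j=1,2,3).$$ Then the functions $q_j=q_j(\boldsymbol{t})$, $\eta_j=\eta_j(\boldsymbol{t})$ satisfy on $U$ the Hamiltonian system $$\frac{\partial q_j}{\partial t_i}=\frac{\partial H_{t_i}(\boldsymbol{t},\boldsymbol{q},\boldsymbol{\eta})}{\partial\eta_j},\qquad \frac{\partial \eta_j}{\partial t_i}=-\frac{\partial H_{t_i}(\boldsymbol{t},\boldsymbol{q},\boldsymbol{\eta})}{\partial q_j}\qquad (i=0,1,2,\ j=1,2,3),$$ where $H_{t_0},H_{t_1},H_{t_2}$ are the explicit Hamiltonians given in the context.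
   Context: The Hamiltonians $H_{t_i}(\boldsymbol{t},\boldsymbol{q},\boldsymbol{\eta})$ ($i=0,1,2$) are the following rational functions of nine independent variables $\boldsymbol{t}=(t_0,t_1,t_2)\in(\mathbb{C}^* )^3$, $\boldsymbol{q}=(q_1,q_2,q_3)$ and $\boldsymbol{\eta}=(\eta_1,\eta_2,\eta_3)$, defined where $q_j\neq 0,1$ and $q_1,q_2,q_3$ are pairwise distinct. In the system, the partial derivatives of $H_{t_i}$ with respect to $\eta_j$ and $q_j$ are taken with all nine variables treated as independent, and are then evaluated at $\boldsymbol{q}=\boldsymbol{q}(\boldsymbol{t})$, $\boldsymbol{\eta}=\boldsymbol{\eta}(\boldsymbol{t})$. Put $Q'(x)=(x-q_1)(x-q_2)+(x-q_2)(x-q_3)+(x-q_3)(x-q_1)$, $\sigma_1=q_1+q_2+q_3$, $\sigma_2=q_1q_2+q_2q_3+q_3q_1$, $\sigma_3=q_1q_2q_3$. (So $Q'(q_j)=\prod_{k\ne j}(q_j-q_k)$; $Q'(q_j)$, $\sigma_1,\sigma_2,\sigma_3$ are functions of $\boldsymbol q$ and must be differentiated as such.) Then $$\begin{aligned} H_{t_0}={}&-\frac{q_1q_2q_3}{t_0}\sum_{j=1}^3\left(\frac{q_j(q_j-1)^2}{Q'(q_j)}\eta_j^2-\frac{5q_j^2-9q_j+4}{3\,Q'(q_j)}\eta_j\right)+\sum_{j=1}^3\frac{4t_0}{q_j^2}+\frac{144t_0^2+144t_1^2-13}{36\,t_0}\\ &+\frac{4t_2^2\,\sigma_3(\sigma_1-2)}{t_0}-\frac{4t_0(2\sigma_2-\sigma_1)}{q_1q_2q_3}\\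 &-\frac{4t_1^2\left(\sigma_1^2-2\sigma_1\sigma_2+3\sigma_1\sigma_3+\sigma_2^2-2\sigma_2\sigma_3-2\sigma_1+2\sigma_2-4\sigma_3+1\right)}{t_0(q_1-1)^2(q_2-1)^2(q_3-1)^2}, \end{aligned}$$ $$\begin{aligned} H_{t_1}={}&-\frac{(q_1-1)(q_2-1)(q_3-1)}{t_1}\sum_{j=1}^3\left(\frac{q_j^2(q_j-1)}{Q'(q_j)}\eta_j^2-\frac{q_j(5q_j-1)}{3\,Q'(q_j)}\eta_j\right)+\sum_{j=1}^3\frac{4t_1}{(q_j-1)^2}+\frac{144t_0^2+144t_1^2-13}{36\,t_1}\\ &+\frac{4t_2^2(\sigma_1-\sigma_2+\sigma_3-1)(\sigma_1-1)}{t_1}+\frac{4t_1(2\sigma_2-3\sigma_1+3)}{(q_1-1)(q_2-1)(q_3-1)}\\ &-\frac{4t_0^2\left(\sigma_1\sigma_2-\sigma_1\sigma_3-\sigma_2^2+2\sigma_2\sigma_3-\sigma_2+\sigma_3\right)}{t_1\,q_1^2q_2^2q_3^2}, \end{aligned}$$ $$\begin{aligned} H_{t_2}={}&-\frac{1}{t_2}\sum_{j=1}^3\left(\frac{q_j^2(q_j-1)^2}{Q'(q_j)}\eta_j^2-\frac{q_j(2q_j^2-3q_j+1)}{3\,Q'(q_j)}\eta_j\right)+4t_2(\sigma_1^2-2\sigma_1-\sigma_2+1)-\frac{1}{36\,t_2}\\ &-\frac{4t_0^2(2\sigma_3-\sigma_2)}{t_2\,q_1^2q_2^2q_3^2}+\frac{4t_1^2(2\sigma_3-\sigma_2+1)}{t_2(q_1-1)^2(q_2-1)^2(q_3-1)^2}.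 \end{aligned}$$ *)

theory Defs
  imports "HOL-Analysis.Analysis"
begin

text \<open>
  Triples of complex numbers have type \<open>complex^3\<close>. The elements of the index type \<open>3\<close> are
  \<open>0, 1, 2\<close> with \<open>3 = 0\<close>, so both index ranges \<open>{0,1,2}\<close> (for \<open>t\<close> and \<open>s\<close>) and
  \<open>{1,2,3}\<close> (for \<open>q\<close> and \<open>\<eta>\<close>) enumerate the whole type.
\<close>

text \<open>
  Holomorphy in several variables. The library's \<open>holomorphic_on\<close> covers only one variable, and
  \<open>has_derivative\<close> alone gives a real-linear derivative, hence the explicit complex homogeneity.
\<close>

definition holomorphic_multi_on :: "(complex^'n \<Rightarrow> complex) \<Rightarrow> (complex^'n) set \<Rightarrow> bool"
    (infixl \<open>holomorphic'_multi'_on\<close> 50) where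
  "f holomorphic_multi_on U \<longleftrightarrow>
     (\<forall>x\<in>U. \<exists>D. (f has_derivative D) (at x) \<and> (\<forall>c v. D (c *s v) = c * D v))"

definition subst_coord :: "'a^'n \<Rightarrow> 'n \<Rightarrow> 'a \<Rightarrow> 'a^'n" where
  "subst_coord x i z = (\<chi> k. if k = i then z else x $ k)"

definition partial_deriv :: "'n \<Rightarrow> (complex^'n \<Rightarrow> complex) \<Rightarrow> complex^'n \<Rightarrow> complex" where
  "partial_deriv i f x = deriv (\<lambda>z. f (subst_coord x i z)) (x $ i)"

definition Q' :: "complex^3 \<Rightarrow> complex \<Rightarrow> complex" where
  "Q' q x = (x - q$1) * (x - q$2) + (x - q$2) * (x - q$3) + (x - q$3) * (x - q$1)"

definition \<sigma>\<^sub>1 :: "complex^3 \<Rightarrow> complex" where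
  "\<sigma>\<^sub>1 q = q$1 + q$2 + q$3"

definition \<sigma>\<^sub>2 :: "complex^3 \<Rightarrow> complex" where
  "\<sigma>\<^sub>2 q = q$1 * q$2 + q$2 * q$3 + q$3 * q$1"

definition \<sigma>\<^sub>3 :: "complex^3 \<Rightarrow> complex" where
  "\<sigma>\<^sub>3 q = q$1 * q$2 * q$3"

definition H\<^sub>0 :: "complex^3 \<Rightarrow> complex^3 \<Rightarrow> complex^3 \<Rightarrow> complex" where
  "H\<^sub>0 t q \<eta> =
     - (q$1 * q$2 * q$3 / t$0) *
         (\<Sum>j\<in>UNIV. q$j * (q$j - 1)^2 / Q' q (q$j) * (\<eta>$j)^2
                  - (5 * (q$j)^2 - 9 * q$j + 4) / (3 * Q' q (q$j)) * \<eta>$j)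
     + (\<Sum>j\<in>UNIV. 4 * t$0 / (q$j)^2)
     + (144 * (t$0)^2 + 144 * (t$1)^2 - 13) / (36 * t$0)
     + 4 * (t$2)^2 * \<sigma>\<^sub>3 q * (\<sigma>\<^sub>1 q - 2) / t$0
     - 4 * t$0 * (2 * \<sigma>\<^sub>2 q - \<sigma>\<^sub>1 q) / (q$1 * q$2 * q$3)
     - 4 * (t$1)^2 *
         ((\<sigma>\<^sub>1 q)^2 - 2 * \<sigma>\<^sub>1 q * \<sigma>\<^sub>2 q + 3 * \<sigma>\<^sub>1 q * \<sigma>\<^sub>3 q + (\<sigma>\<^sub>2 q)^2 - 2 * \<sigma>\<^sub>2 q * \<sigma>\<^sub>3 q
            - 2 * \<sigma>\<^sub>1 q + 2 * \<sigma>\<^sub>2 q - 4 * \<sigma>\<^sub>3 q + 1)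
         / (t$0 * (q$1 - 1)^2 * (q$2 - 1)^2 * (q$3 - 1)^2)"

definition H\<^sub>1 :: "complex^3 \<Rightarrow> complex^3 \<Rightarrow> complex^3 \<Rightarrow> complex" where
  "H\<^sub>1 t q \<eta> =
     - ((q$1 - 1) * (q$2 - 1) * (q$3 - 1) / t$1) *
         (\<Sum>j\<in>UNIV. (q$j)^2 * (q$j - 1) / Q' q (q$j) * (\<eta>$j)^2
                  - q$j * (5 * q$j - 1) / (3 * Q' q (q$j)) * \<eta>$j)
     + (\<Sum>j\<in>UNIV. 4 * t$1 / (q$j - 1)^2)
     + (144 * (t$0)^2 + 144 * (t$1)^2 - 13) / (36 * t$1)
     + 4 * (t$2)^2 * (\<sigma>\<^sub>1 q - \<sigma>\<^sub>2 q + \<sigma>\<^sub>3 q - 1) * (\<sigma>\<^sub>1 q - 1) / t$1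
     + 4 * t$1 * (2 * \<sigma>\<^sub>2 q - 3 * \<sigma>\<^sub>1 q + 3) / ((q$1 - 1) * (q$2 - 1) * (q$3 - 1))
     - 4 * (t$0)^2 *
         (\<sigma>\<^sub>1 q * \<sigma>\<^sub>2 q - \<sigma>\<^sub>1 q * \<sigma>\<^sub>3 q - (\<sigma>\<^sub>2 q)^2 + 2 * \<sigma>\<^sub>2 q * \<sigma>\<^sub>3 q - \<sigma>\<^sub>2 q + \<sigma>\<^sub>3 q)
         / (t$1 * (q$1)^2 * (q$2)^2 * (q$3)^2)"

definition H\<^sub>2 :: "complex^3 \<Rightarrow> complex^3 \<Rightarrow> complex^3 \<Rightarrow> complex" where
  "H\<^sub>2 t q \<eta> =
     - (1 / t$2) *
         (\<Sum>j\<in>UNIV. (q$j)^2 * (q$j - 1)^2 / Q' q (q$j) * (\<eta>$j)^2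
                  - q$j * (2 * (q$j)^2 - 3 * q$j + 1) / (3 * Q' q (q$j)) * \<eta>$j)
     + 4 * t$2 * ((\<sigma>\<^sub>1 q)^2 - 2 * \<sigma>\<^sub>1 q - \<sigma>\<^sub>2 q + 1)
     - 1 / (36 * t$2)
     - 4 * (t$0)^2 * (2 * \<sigma>\<^sub>3 q - \<sigma>\<^sub>2 q) / (t$2 * (q$1)^2 * (q$2)^2 * (q$3)^2)
     + 4 * (t$1)^2 * (2 * \<sigma>\<^sub>3 q - \<sigma>\<^sub>2 q + 1)
         / (t$2 * (q$1 - 1)^2 * (q$2 - 1)^2 * (q$3 - 1)^2)"

definition H :: "3 \<Rightarrow> complex^3 \<Rightarrow> complex^3 \<Rightarrow> complex^3 \<Rightarrow> complex" where
  "H i = (if i = 0 then H\<^sub>0 else if i = 1 then H\<^sub>1 else H\<^sub>2)"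

text \<open>
  \<open>partial_deriv\<close> is built on the total operator \<open>deriv\<close>, which has a default value where the
  derivative does not exist. The facts below show that the partial derivatives of holomorphic
  functions, and those of \<open>H\<close> on its domain of definition, are genuine.
\<close>

lemma holomorphic_multi_on_has_partial_deriv:
  assumes "f holomorphic_multi_on U" and "x \<in> U"
  shows "((\<lambda>z. f (subst_coord x i z)) has_field_derivative partial_deriv i f x) (at (x $ i))"
proof -
  obtain D where D: "(f has_derivative D) (at x)" and hom: "\<And>c v. D (c *s v) = c * D v"
    using assms unfolding holomorphic_multi_on_def by blast
  have eq: "subst_coord x i z = x + (z - x $ i) *s axis i 1" for z
    by (auto simp: subst_coord_def vec_eq_iff axis_def)
  have lin: "bounded_linear (\<lambda>h::complex. h *s axis i (1::complex))"
    by (intro linear_conv_bounded_linear[THEN iffD1] linearI)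
       (auto simp: vec_eq_iff axis_def algebra_simps)
  have "(subst_coord x i has_derivative (\<lambda>h. h *s axis i 1)) (at (x $ i))"
  proof -
    have "((\<lambda>z. x + (z - x $ i) *s axis i (1::complex)) has_derivative (\<lambda>h. 0 + (h - 0) *s axis i 1))
            (at (x $ i))"
      by (intro has_derivative_add has_derivative_const bounded_linear.has_derivative[OF lin]
            has_derivative_diff has_derivative_ident)
    then show ?thesis by (simp add: eq[abs_def])
  qed
  moreover have "subst_coord x i (x $ i) = x"
    by (simp add: eq)
  ultimately have "((f \<circ> subst_coord x i) has_derivative (D \<circ> (\<lambda>h. h *s axis i 1))) (at (x $ i))"
    using D by (intro diff_chain_at) auto
  then have "((\<lambda>z. f (subst_coord x i z)) has_field_derivative D (axis i 1)) (at (x $ i))"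
    by (simp add: has_field_derivative_def o_def hom mult.commute[of _ "D (axis i 1)"] mult_commute_abs)
  then show ?thesis
    unfolding partial_deriv_def by (metis DERIV_imp_deriv)
qed

lemma Q'_at:
  "Q' q (q$1) = (q$1 - q$2) * (q$1 - q$3)"
  "Q' q (q$2) = (q$2 - q$1) * (q$2 - q$3)"
  "Q' q (q$3) = (q$3 - q$1) * (q$3 - q$2)"
  by (simp_all add: Q'_def algebra_simps)

lemma H_has_partial_deriv:
  assumes "\<And>i. t $ i \<noteq> 0" and "\<And>j. q $ j \<noteq> 0" and "\<And>j. q $ j \<noteq> 1"
    and "\<And>j k. j \<noteq> k \<Longrightarrow> q $ j \<noteq> q $ k"
  shows "((\<lambda>z. H i t q (subst_coord \<eta> j z)) has_field_derivative
           partial_deriv j (\<lambda>\<eta>. H i t q \<eta>) \<eta>) (at (\<eta> $ j))"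
    and "((\<lambda>z. H i t (subst_coord q j z) \<eta>) has_field_derivative
           partial_deriv j (\<lambda>q. H i t q \<eta>) q) (at (q $ j))"
proof -
  have d: "q$1 \<noteq> q$2" "q$2 \<noteq> q$1" "q$1 \<noteq> q$3" "q$3 \<noteq> q$1" "q$2 \<noteq> q$3" "q$3 \<noteq> q$2"
    by (rule assms(4); simp)+
  have coord: "(\<lambda>z. subst_coord x j z $ k) field_differentiable F" for x :: "complex^3" and k F
    by (cases "k = j") (simp_all add: subst_coord_def field_differentiable_ident)
  have at: "subst_coord x j (x $ j) = x" for x :: "complex^3"
    by (simp add: subst_coord_def vec_eq_iff)
  note diff = field_differentiable_add field_differentiable_diff field_differentiable_minus
    field_differentiable_mult field_differentiable_divide field_differentiable_power
    field_differentiable_const coord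
  have "(\<lambda>z. H\<^sub>0 t q (subst_coord \<eta> j z)) field_differentiable at (\<eta> $ j)"
       "(\<lambda>z. H\<^sub>1 t q (subst_coord \<eta> j z)) field_differentiable at (\<eta> $ j)"
       "(\<lambda>z. H\<^sub>2 t q (subst_coord \<eta> j z)) field_differentiable at (\<eta> $ j)"
    unfolding H\<^sub>0_def H\<^sub>1_def H\<^sub>2_def sum_3 Q'_at \<sigma>\<^sub>1_def \<sigma>\<^sub>2_def \<sigma>\<^sub>3_def
    by (intro diff; simp add: at d assms(1-3))+
  then have "(\<lambda>z. H i t q (subst_coord \<eta> j z)) field_differentiable at (\<eta> $ j)"
    by (simp add: H_def)
  then show "((\<lambda>z. H i t q (subst_coord \<eta> j z)) has_field_derivative
           partial_deriv j (\<lambda>\<eta>. H i t q \<eta>) \<eta>) (at (\<eta> $ j))"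
    unfolding partial_deriv_def by (simp add: DERIV_deriv_iff_field_differentiable)
  have "(\<lambda>z. H\<^sub>0 t (subst_coord q j z) \<eta>) field_differentiable at (q $ j)"
       "(\<lambda>z. H\<^sub>1 t (subst_coord q j z) \<eta>) field_differentiable at (q $ j)"
       "(\<lambda>z. H\<^sub>2 t (subst_coord q j z) \<eta>) field_differentiable at (q $ j)"
    unfolding H\<^sub>0_def H\<^sub>1_def H\<^sub>2_def sum_3 Q'_at \<sigma>\<^sub>1_def \<sigma>\<^sub>2_def \<sigma>\<^sub>3_def
    by (intro diff; simp add: at d assms(1-3))+
  then have "(\<lambda>z. H i t (subst_coord q j z) \<eta>) field_differentiable at (q $ j)"
    by (simp add: H_def)
  then show "((\<lambda>z. H i t (subst_coord q j z) \<eta>) has_field_derivative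
           partial_deriv j (\<lambda>q. H i t q \<eta>) q) (at (q $ j))"
    unfolding partial_deriv_def by (simp add: DERIV_deriv_iff_field_differentiable)
qed

end

theory Submission
  imports Defs
begin

text \<open>
  Up to a function of \<open>t\<close> alone, \<open>t\<^sub>i H\<^sub>i\<close> is a kinetic part, quadratic in \<open>\<eta>\<close> and independent of \<open>t\<close>,
  plus a potential part that depends on \<open>q\<close> and on the squares \<open>t\<^sub>k\<^sup>2\<close>. On the graph
  \<open>\<eta>\<^sub>j = 1/(3q\<^sub>j) + 1/(3(q\<^sub>j - 1))\<close> the kinetic part is constant, because it is the product of a
  symmetric function and a second divided difference that can be evaluated. By the chain rule its
  partial derivative in \<open>q\<^sub>j\<close> is therefore \<open>- d\<eta>\<^sub>j/dq\<^sub>j\<close> times its partial derivative in \<open>\<eta>\<^sub>j\<close>. Hence the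
  equations for \<open>\<eta>\<close> follow from those for \<open>q\<close> as soon as the potential part is critical at \<open>q(t)\<close>.

  Twice the cubic, multiplied by \<open>s\<^sub>2\<close>, is \<open>s\<^sub>0(x-1)(x-2) - s\<^sub>1x(x+1) + s\<^sub>2x(x-1)(2x-1)\<close>. Its values at \<open>0\<close>
  and \<open>1\<close> give \<open>s\<^sub>0 = -s\<^sub>2\<sigma>\<^sub>3\<close> and \<open>s\<^sub>1 = s\<^sub>2\<Prod>(q\<^sub>j-1)\<close>, and the quadratic coefficient then becomes the single
  relation \<open>\<sigma>\<^sub>1 + \<sigma>\<^sub>2 = 2\<sigma>\<^sub>3 + 2\<close>. These facts make the potential part critical. The equations for \<open>q\<close>
  come from implicit differentiation of the cubic, with \<open>\<partial>s\<^sub>i/\<partial>t\<^sub>i = 2s\<^sub>i/(3t\<^sub>i)\<close>.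
\<close>

section \<open>Splitting the Hamiltonians into kinetic and potential parts\<close>

text \<open>The second divided difference at the nodes \<open>x\<close>, \<open>y\<close>,
  \<open>z\<close> with values \<open>u\<close>, \<open>v\<close>, \<open>w\<close>. The
  denominators are ordered so that a rotation of the nodes merely permutes the summands.\<close>

definition div_diff :: "'a::field \<Rightarrow> 'a \<Rightarrow> 'a \<Rightarrow> 'a \<Rightarrow> 'a \<Rightarrow> 'a \<Rightarrow> 'a" where
  "div_diff x y z u v w = u / ((x - y) * (x - z)) + v / ((y - z) * (y - x)) + w / ((z - x) * (z - y))"

text \<open>At the roots of the cubic this is \<open>s_i / s_2\<close> up to sign, which ties the
  Hamiltonians to the Vieta relations.\<close>

definition prefactor :: "3 \<Rightarrow> complex \<Rightarrow> complex \<Rightarrow> complex \<Rightarrow> complex" where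
  "prefactor i x y z =
     (if i = 0 then x * y * z else if i = 1 then (x - 1) * (y - 1) * (z - 1) else 1)"

definition quad_coeff :: "3 \<Rightarrow> complex \<Rightarrow> complex" where
  "quad_coeff i x = (if i = 0 then x * (x - 1)^2 else if i = 1 then x^2 * (x - 1) else x^2 * (x - 1)^2)"

definition lin_coeff :: "3 \<Rightarrow> complex \<Rightarrow> complex" where
  "lin_coeff i x = (if i = 0 then (5 * x^2 - 9 * x + 4) / 3 else if i = 1 then x * (5 * x - 1) / 3
     else x * (2 * x^2 - 3 * x + 1) / 3)"

definition kinetic :: "3 \<Rightarrow> complex \<Rightarrow> complex \<Rightarrow> complex \<Rightarrow> complex \<Rightarrow> complex \<Rightarrow> complex \<Rightarrow> complex" where
  "kinetic i x y z a b c = - prefactor i x y z *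
     div_diff x y z (quad_coeff i x * a^2 - lin_coeff i x * a)
       (quad_coeff i y * b^2 - lin_coeff i y * b) (quad_coeff i z * c^2 - lin_coeff i z * c)"

text \<open>Three scalars replace the vector \<open>q\<close>, so that a partial derivative becomes
  an ordinary derivative in the first of them.\<close>

definition potential :: "3 \<Rightarrow> complex^3 \<Rightarrow> complex \<Rightarrow> complex \<Rightarrow> complex \<Rightarrow> complex" where
  "potential i t x y z =
     (let e\<^sub>1 = x + y + z; e\<^sub>2 = x * y + y * z + z * x; e\<^sub>3 = x * y * z; d = (x - 1) * (y - 1) * (z - 1) in
      if i = 0 then
        (t$0)^2 * (1 / x^2 + 1 / y^2 + 1 / z^2 - (2 * e\<^sub>2 - e\<^sub>1) / e\<^sub>3)
        - (t$1)^2 * (e\<^sub>3 * (e\<^sub>1 - e\<^sub>3 - 2) / d^2) + (t$2)^2 * (e\<^sub>3 * (e\<^sub>1 - 2))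
      else if i = 1 then
        (t$0)^2 * (d * (d - e\<^sub>1 + 1) / e\<^sub>3^2)
        + (t$1)^2 * (1 / (x - 1)^2 + 1 / (y - 1)^2 + 1 / (z - 1)^2 + (2 * e\<^sub>2 - 3 * e\<^sub>1 + 3) / d)
        + (t$2)^2 * (d * (e\<^sub>1 - 1))
      else
        (t$2)^2 * (e\<^sub>1^2 - 2 * e\<^sub>1 - e\<^sub>2 + 1) - (t$0)^2 * ((2 * e\<^sub>3 - e\<^sub>2) / e\<^sub>3^2)
        + (t$1)^2 * ((2 * e\<^sub>3 - e\<^sub>2 + 1) / d^2))"

lemma exhaust_3_from_0: "i = 0 \<or> i = 1 \<or> i = 2" for i :: 3
  using exhaust_3[of i] by auto

text \<open>In \<open>H\<^sub>0\<close> and \<open>H\<^sub>1\<close> the numerator of the last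
  fraction splits off the square of a product that its denominator contains. What this leaves
  cancels the mixed term \<open>144 t_1^2 / (36 t_0)\<close> or \<open>144 t_0^2 / (36 t_1)\<close>,
  so the remainder depends on \<open>t_i\<close> alone.\<close>

lemma H_decomposition:
  assumes "\<And>i. t $ i \<noteq> 0" and "\<And>j. q $ j \<noteq> 1" and "\<And>j. q $ j \<noteq> 0"
  shows "H i t q \<eta> = (kinetic i (q$1) (q$2) (q$3) (\<eta>$1) (\<eta>$2) (\<eta>$3)
       + 4 * potential i t (q$1) (q$2) (q$3)) / t$i
       + (if i = 2 then - 1 / (36 * t$2) else (144 * (t$i)^2 - 13) / (36 * t$i))"
proof -
  have nz: "q$1 \<noteq> 0" "q$2 \<noteq> 0" "q$3 \<noteq> 0" "q$1 - 1 \<noteq> 0" "q$2 - 1 \<noteq> 0" "q$3 - 1 \<noteq> 0"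
    "t$0 \<noteq> 0" "t$1 \<noteq> 0" "t$2 \<noteq> 0"
    using assms by auto
  define K where "K p r = (\<Sum>j\<in>UNIV. p (q$j) / Q' q (q$j) * (\<eta>$j)^2 - r (q$j) / Q' q (q$j) * \<eta>$j)"
    for p r :: "complex \<Rightarrow> complex"
  have K: "kinetic i (q$1) (q$2) (q$3) (\<eta>$1) (\<eta>$2) (\<eta>$3)
     = - prefactor i (q$1) (q$2) (q$3) * K (quad_coeff i) (lin_coeff i)" for i
    unfolding kinetic_def K_def div_diff_def sum_3 Q'_at
    by (simp add: diff_divide_distrib mult_ac)
  let ?d = "(q$1 - 1) * (q$2 - 1) * (q$3 - 1)"
  have frac: "k * (p + r) / (l * a^2 * b^2 * c^2) = k * (p / (a * b * c)^2 + r / (a * b * c)^2) / l"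
    for k p r l a b c :: complex
    by (simp add: power_mult_distrib add_divide_distrib distrib_left mult_ac)
  note * = \<sigma>\<^sub>1_def \<sigma>\<^sub>2_def \<sigma>\<^sub>3_def
  consider "i = 0" | "i = 1" | "i = 2" using exhaust_3_from_0 by blast
  then show ?thesis
  proof cases
    case 1
    have N: "(\<sigma>\<^sub>1 q)^2 - 2 * \<sigma>\<^sub>1 q * \<sigma>\<^sub>2 q + 3 * \<sigma>\<^sub>1 q * \<sigma>\<^sub>3 q + (\<sigma>\<^sub>2 q)^2 - 2 * \<sigma>\<^sub>2 q * \<sigma>\<^sub>3 q
            - 2 * \<sigma>\<^sub>1 q + 2 * \<sigma>\<^sub>2 q - 4 * \<sigma>\<^sub>3 q + 1
       = ?d^2 + \<sigma>\<^sub>3 q * (\<sigma>\<^sub>1 q - \<sigma>\<^sub>3 q - 2)"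
      unfolding * by algebra
    \<comment> \<open>With these quotients and \<open>K\<close> kept opaque, the concluding identity
      has only components of \<open>t\<close> and numbers in its denominators.\<close>
    define u where "u = 1 / (q$1)^2 + 1 / (q$2)^2 + 1 / (q$3)^2"
    define m where "m = (2 * \<sigma>\<^sub>2 q - \<sigma>\<^sub>1 q) / (q$1 * q$2 * q$3)"
    define n where "n = \<sigma>\<^sub>3 q * (\<sigma>\<^sub>1 q - \<sigma>\<^sub>3 q - 2) / ?d^2"
    have sum: "(\<Sum>j\<in>UNIV. q$j * (q$j - 1)^2 / Q' q (q$j) * (\<eta>$j)^2
                  - (5 * (q$j)^2 - 9 * q$j + 4) / (3 * Q' q (q$j)) * \<eta>$j) = K (quad_coeff 0) (lin_coeff 0)"
      by (simp add: K_def quad_coeff_def lin_coeff_def)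
    have u: "(\<Sum>j\<in>UNIV. 4 * t$0 / (q$j)^2) = 4 * t$0 * u"
      by (simp add: u_def sum_3 distrib_left)
    have m: "4 * t$0 * (2 * \<sigma>\<^sub>2 q - \<sigma>\<^sub>1 q) / (q$1 * q$2 * q$3) = 4 * t$0 * m"
      by (simp add: m_def)
    have n: "4 * (t$1)^2 * (?d^2 + \<sigma>\<^sub>3 q * (\<sigma>\<^sub>1 q - \<sigma>\<^sub>3 q - 2)) / (t$0 * (q$1 - 1)^2 * (q$2 - 1)^2 * (q$3 - 1)^2)
       = 4 * (t$1)^2 * (1 + n) / t$0"
      unfolding frac n_def using nz by simp
    have pot: "potential 0 t (q$1) (q$2) (q$3) = (t$0)^2 * (u - m) - (t$1)^2 * n + (t$2)^2 * (\<sigma>\<^sub>3 q * (\<sigma>\<^sub>1 q - 2))"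
      by (simp add: potential_def Let_def * u_def m_def n_def)
    have PH: "prefactor 0 (q$1) (q$2) (q$3) = q$1 * q$2 * q$3" "H 0 = H\<^sub>0"
      by (simp_all add: prefactor_def H_def)
    show ?thesis
      using nz unfolding 1 K PH pot H\<^sub>0_def N sum u m n
      by (simp add: field_simps power2_eq_square)
  next
    case 2
    define u where "u = 1 / (q$1 - 1)^2 + 1 / (q$2 - 1)^2 + 1 / (q$3 - 1)^2"
    define m where "m = (2 * \<sigma>\<^sub>2 q - 3 * \<sigma>\<^sub>1 q + 3) / ?d"
    define n where "n = ?d * (?d - \<sigma>\<^sub>1 q + 1) / (q$1 * q$2 * q$3)^2"
    define d where "d = ?d"
    have N: "\<sigma>\<^sub>1 q * \<sigma>\<^sub>2 q - \<sigma>\<^sub>1 q * \<sigma>\<^sub>3 q - (\<sigma>\<^sub>2 q)^2 + 2 * \<sigma>\<^sub>2 q * \<sigma>\<^sub>3 q - \<sigma>\<^sub>2 q + \<sigma>\<^sub>3 q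
       = (q$1 * q$2 * q$3)^2 + - (?d * (?d - \<sigma>\<^sub>1 q + 1))" and d: "\<sigma>\<^sub>1 q - \<sigma>\<^sub>2 q + \<sigma>\<^sub>3 q - 1 = ?d"
      unfolding * by algebra+
    have sum: "(\<Sum>j\<in>UNIV. (q$j)^2 * (q$j - 1) / Q' q (q$j) * (\<eta>$j)^2
                  - q$j * (5 * q$j - 1) / (3 * Q' q (q$j)) * \<eta>$j) = K (quad_coeff 1) (lin_coeff 1)"
      by (simp add: K_def quad_coeff_def lin_coeff_def)
    have u: "(\<Sum>j\<in>UNIV. 4 * t$1 / (q$j - 1)^2) = 4 * t$1 * u"
      by (simp add: u_def sum_3 distrib_left)
    have m: "4 * t$1 * (2 * \<sigma>\<^sub>2 q - 3 * \<sigma>\<^sub>1 q + 3) / ?d = 4 * t$1 * m"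
      by (simp add: m_def)
    have n: "4 * (t$0)^2 * ((q$1 * q$2 * q$3)^2 + - (?d * (?d - \<sigma>\<^sub>1 q + 1))) / (t$1 * (q$1)^2 * (q$2)^2 * (q$3)^2)
       = 4 * (t$0)^2 * (1 - n) / t$1"
      unfolding frac n_def using nz by simp
    have pot: "potential 1 t (q$1) (q$2) (q$3) = (t$0)^2 * n + (t$1)^2 * (u + m) + (t$2)^2 * (?d * (\<sigma>\<^sub>1 q - 1))"
      by (simp add: potential_def Let_def * u_def m_def n_def)
    have PH: "prefactor 1 (q$1) (q$2) (q$3) = ?d" "H 1 = H\<^sub>1"
      by (simp_all add: prefactor_def H_def)
    show ?thesis
      using nz unfolding 2 K PH pot H\<^sub>1_def N d sum u m n unfolding d_def[symmetric]
      by (simp add: field_simps power2_eq_square)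
  next
    case 3
    have sum: "(\<Sum>j\<in>UNIV. (q$j)^2 * (q$j - 1)^2 / Q' q (q$j) * (\<eta>$j)^2
                  - q$j * (2 * (q$j)^2 - 3 * q$j + 1) / (3 * Q' q (q$j)) * \<eta>$j) = K (quad_coeff 2) (lin_coeff 2)"
      by (simp add: K_def quad_coeff_def lin_coeff_def)
    define m where "m = (2 * \<sigma>\<^sub>3 q - \<sigma>\<^sub>2 q) / (q$1 * q$2 * q$3)^2"
    define n where "n = (2 * \<sigma>\<^sub>3 q - \<sigma>\<^sub>2 q + 1) / ?d^2"
    have m: "4 * (t$0)^2 * (2 * \<sigma>\<^sub>3 q - \<sigma>\<^sub>2 q) / (t$2 * (q$1)^2 * (q$2)^2 * (q$3)^2) = 4 * (t$0)^2 * m / t$2"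
      by (simp add: m_def power_mult_distrib mult_ac)
    have n: "4 * (t$1)^2 * (2 * \<sigma>\<^sub>3 q - \<sigma>\<^sub>2 q + 1) / (t$2 * (q$1 - 1)^2 * (q$2 - 1)^2 * (q$3 - 1)^2)
       = 4 * (t$1)^2 * n / t$2"
      by (simp add: n_def power_mult_distrib mult_ac)
    have pot: "potential 2 t (q$1) (q$2) (q$3) = (t$2)^2 * ((\<sigma>\<^sub>1 q)^2 - 2 * \<sigma>\<^sub>1 q - \<sigma>\<^sub>2 q + 1) - (t$0)^2 * m + (t$1)^2 * n"
      by (simp add: potential_def Let_def * m_def n_def)
    have PH: "prefactor 2 (q$1) (q$2) (q$3) = 1" "H 2 = H\<^sub>2"
      by (simp_all add: prefactor_def H_def)
    show ?thesis
      using nz unfolding 3 K PH pot H\<^sub>2_def sum m n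
      by (simp add: field_simps power2_eq_square)
  qed
qed

text \<open>Cyclic invariance allows any chosen coordinate to be moved into the first place.\<close>

lemma kinetic_rotate: "kinetic i y z x b c a = kinetic i x y z a b c"
  by (simp add: kinetic_def div_diff_def prefactor_def mult_ac add_ac)

lemma potential_rotate: "potential i t y z x = potential i t x y z"
  by (simp add: potential_def Let_def mult_ac add_ac)

section \<open>The kinetic part along the momentum graph\<close>

definition \<eta>_graph :: "complex \<Rightarrow> complex" where
  "\<eta>_graph x = 1 / (3 * x) + 1 / (3 * (x - 1))"

lemma \<eta>_graph_eq: "x \<noteq> 0 \<Longrightarrow> x \<noteq> 1 \<Longrightarrow> \<eta>_graph x = (2 * x - 1) / (3 * x * (x - 1))"
  unfolding \<eta>_graph_def by (simp add: divide_simps) algebra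

text \<open>Up to sign and the factor 1/3, the right-hand side is the polynomial multiplying
  \<open>s_i\<close> in the cubic. This is where the Hamiltonian velocity meets implicit
  differentiation.\<close>

lemma momentum_coeff_on_graph:
  assumes "x \<noteq> 0" "x \<noteq> 1"
  shows "2 * quad_coeff i x * \<eta>_graph x - lin_coeff i x =
    (if i = 0 then - ((x - 1) * (x - 2)) else if i = 1 then - (x * (x + 1)) else x * (x - 1) * (2 * x - 1)) / 3"
proof -
  consider "i = 0" | "i = 1" | "i = 2" using exhaust_3_from_0 by blast
  then show ?thesis
  proof cases
    case 1
    show ?thesis
      by (simp add: 1 quad_coeff_def lin_coeff_def \<eta>_graph_eq assms divide_simps) algebra
  next
    case 2
    show ?thesis
      by (simp add: 2 quad_coeff_def lin_coeff_def \<eta>_graph_eq assms divide_simps) algebra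
  next
    case 3
    show ?thesis
      by (simp add: 3 quad_coeff_def lin_coeff_def \<eta>_graph_eq assms divide_simps) algebra
  qed
qed

text \<open>On the graph each node value is affine plus a multiple of \<open>1 / w\<close> or
  \<open>1 / (w - 1)\<close>, or zero for \<open>i = 2\<close>. Second divided differences kill
  affine functions and send \<open>1 / (w - n)\<close> to the reciprocal of the product of the
  \<open>w - n\<close>, which the prefactor cancels.\<close>

lemma kinetic_on_graph:
  assumes "x \<noteq> y" "y \<noteq> z" "z \<noteq> x" "x \<noteq> 0" "y \<noteq> 0" "z \<noteq> 0" "x \<noteq> 1" "y \<noteq> 1" "z \<noteq> 1"
  shows "kinetic i x y z (\<eta>_graph x) (\<eta>_graph y) (\<eta>_graph z) = (if i = 2 then 0 else 1 / 3)"
proof -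
  \<comment> \<open>The redundant \<open>w - 0\<close> and \<open>0 + 0 * w + 0 * w\<close> give all
    three cases the shape expected by \<open>affine\<close> and \<open>recip\<close>.\<close>
  have g: "quad_coeff 0 w * (\<eta>_graph w)^2 - lin_coeff 0 w * \<eta>_graph w = 1 + - 2 / 3 * w + - 1 / 3 * (1 / (w - 0))"
      "quad_coeff 1 w * (\<eta>_graph w)^2 - lin_coeff 1 w * \<eta>_graph w = - 1 / 3 + - 2 / 3 * w + - 1 / 3 * (1 / (w - 1))"
      "quad_coeff 2 w * (\<eta>_graph w)^2 - lin_coeff 2 w * \<eta>_graph w = 0 + 0 * w + 0 * w"
    if "w \<noteq> 0" "w \<noteq> 1" for w
    by (simp_all add: that \<eta>_graph_eq quad_coeff_def lin_coeff_def divide_simps; algebra)+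
  have affine: "div_diff x y z (p + r * x + k * u) (p + r * y + k * v) (p + r * z + k * w)
    = k * div_diff x y z u v w" for p r k u v w
    unfolding div_diff_def by (simp add: assms(1-3) assms(1-3)[symmetric] divide_simps) algebra
  have recip: "div_diff x y z (1 / (x - n)) (1 / (y - n)) (1 / (z - n)) = 1 / ((x - n) * (y - n) * (z - n))"
    if "x \<noteq> n" "y \<noteq> n" "z \<noteq> n" for n
    unfolding div_diff_def by (simp add: assms(1-3) assms(1-3)[symmetric] that divide_simps) algebra
  consider "i = 0" | "i = 1" | "i = 2" using exhaust_3_from_0 by blast
  then show ?thesis
  proof cases
    case 1
    show ?thesis
      unfolding 1 kinetic_def g(1)[OF assms(4,7)] g(1)[OF assms(5,8)] g(1)[OF assms(6,9)] affine recip[OF assms(4-6)]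
      using assms by (simp add: prefactor_def)
  next
    case 2
    show ?thesis
      unfolding 2 kinetic_def g(2)[OF assms(4,7)] g(2)[OF assms(5,8)] g(2)[OF assms(6,9)] affine recip[OF assms(7-9)]
      using assms by (simp add: prefactor_def)
  next
    case 3
    show ?thesis
      unfolding 3 kinetic_def g(3)[OF assms(4,7)] g(3)[OF assms(5,8)] g(3)[OF assms(6,9)] affine 
      using assms by (simp add: prefactor_def)
  qed
qed

lemma kinetic_momentum_deriv:
  "((\<lambda>a. kinetic i x y z a b c) has_field_derivative
     - prefactor i x y z * ((2 * quad_coeff i x * a - lin_coeff i x) / ((x - y) * (x - z)))) (at a)"
  unfolding kinetic_def div_diff_def divide_inverse
  by (auto intro!: derivative_eq_intros)

text \<open>The total derivative along \<open>e\<close> vanishes, and it is the partial derivative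
  at frozen \<open>e x\<close> plus \<open>e'\<close> times the derivative in the momentum. So the
  former follows without computing the derivatives of \<open>A\<close>, \<open>B\<close>,
  \<open>R\<close>.\<close>

lemma has_field_derivative_partial_of_constant_quadratic:
  fixes A B R e :: "'a::real_normed_field \<Rightarrow> 'a"
  assumes "A field_differentiable (at x)" "B field_differentiable (at x)" "R field_differentiable (at x)"
    and e: "(e has_field_derivative e') (at x)"
    and const: "\<forall>\<^sub>F w in nhds x. A w * (e w)^2 + B w * e w + R w = k"
  shows "((\<lambda>w. A w * (e x)^2 + B w * e x + R w) has_field_derivative - e' * (2 * A x * e x + B x)) (at x)"
proof -
  obtain A' B' R' where d: "(A has_field_derivative A') (at x)" "(B has_field_derivative B') (at x)"
      "(R has_field_derivative R') (at x)"
    using assms(1-3) unfolding field_differentiable_def by blast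
  have "((\<lambda>w. A w * (e w)^2 + B w * e w + R w) has_field_derivative
      A' * (e x)^2 + B' * e x + R' + e' * (2 * A x * e x + B x)) (at x)"
    by (auto intro!: derivative_eq_intros d e simp: algebra_simps)
  moreover have "((\<lambda>w. A w * (e w)^2 + B w * e w + R w) has_field_derivative 0) (at x)"
    using DERIV_cong_ev[OF refl const refl] by simp
  ultimately have "A' * (e x)^2 + B' * e x + R' + e' * (2 * A x * e x + B x) = 0"
    by (rule DERIV_unique)
  then have "A' * (e x)^2 + B' * e x + R' = - e' * (2 * A x * e x + B x)"
    by (simp add: eq_neg_iff_add_eq_0)
  then show ?thesis
    by (auto intro!: derivative_eq_intros d)
qed

lemma \<eta>_graph_deriv:
  assumes "x \<noteq> 0" "x \<noteq> 1"
  shows "(\<eta>_graph has_field_derivative - (1 / (3 * x^2) + 1 / (3 * (x - 1)^2))) (at x)"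
  unfolding \<eta>_graph_def[abs_def] using assms
  by (auto intro!: derivative_eq_intros simp: power2_eq_square) (simp add: divide_simps, algebra)

text \<open>\<open>kinetic\<close> is quadratic in its first momentum and constant along the graph
  near \<open>x\<close>; the factor of \<open>v\<close> is minus the derivative of
  \<open>\<eta>_graph\<close>.\<close>

lemma kinetic_position_deriv:
  assumes "x \<noteq> y" "y \<noteq> z" "z \<noteq> x" "x \<noteq> 0" "y \<noteq> 0" "z \<noteq> 0" "x \<noteq> 1" "y \<noteq> 1" "z \<noteq> 1"
    and "((\<lambda>a. kinetic i x y z a (\<eta>_graph y) (\<eta>_graph z)) has_field_derivative v) (at (\<eta>_graph x))"
  shows "((\<lambda>w. kinetic i w y z (\<eta>_graph x) (\<eta>_graph y) (\<eta>_graph z)) has_field_derivative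
     (1 / (3 * x^2) + 1 / (3 * (x - 1)^2)) * v) (at x)"
proof -
  let ?b = "\<eta>_graph y" and ?c = "\<eta>_graph z"
  define A where "A w = - prefactor i w y z * quad_coeff i w / ((w - y) * (w - z))" for w
  define B where "B w = prefactor i w y z * lin_coeff i w / ((w - y) * (w - z))" for w
  define R where "R w = - prefactor i w y z * div_diff w y z 0
     (quad_coeff i y * ?b^2 - lin_coeff i y * ?b) (quad_coeff i z * ?c^2 - lin_coeff i z * ?c)" for w
  have kin: "kinetic i w y z a ?b ?c = A w * a^2 + B w * a + R w" for w a
    unfolding kinetic_def A_def B_def R_def div_diff_def
    by (simp add: algebra_simps diff_divide_distrib)
  have "\<forall>\<^sub>F w in nhds x. w \<in> - {0, 1, y, z}"
    using assms by (intro eventually_nhds_in_open) (auto intro: finite_imp_closed)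
  then have const: "\<forall>\<^sub>F w in nhds x. A w * (\<eta>_graph w)^2 + B w * \<eta>_graph w + R w = (if i = 2 then 0 else 1 / 3)"
    by eventually_elim (use assms kinetic_on_graph[of _ y z i] in \<open>auto simp: kin[symmetric]\<close>)
  note diff = field_differentiable_add field_differentiable_diff field_differentiable_minus
    field_differentiable_mult field_differentiable_divide field_differentiable_power
    field_differentiable_const field_differentiable_ident
  have "A field_differentiable (at x)" "B field_differentiable (at x)" "R field_differentiable (at x)"
    unfolding A_def B_def R_def div_diff_def prefactor_def quad_coeff_def lin_coeff_def using assms
    by (cases "i = 0"; cases "i = 1"; simp only: if_True if_False; intro diff; simp)+
  from has_field_derivative_partial_of_constant_quadratic[OF this \<eta>_graph_deriv const] assms(4,7)
  have 1: "((\<lambda>w. kinetic i w y z (\<eta>_graph x) ?b ?c) has_field_derivative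
     (1 / (3 * x^2) + 1 / (3 * (x - 1)^2)) * (2 * A x * \<eta>_graph x + B x)) (at x)"
    by (simp add: kin add.commute)
  have "((\<lambda>a. kinetic i x y z a ?b ?c) has_field_derivative 2 * A x * \<eta>_graph x + B x) (at (\<eta>_graph x))"
    unfolding kin by (auto intro!: derivative_eq_intros)
  then show ?thesis using 1 assms(10) DERIV_unique by blast
qed

lemma potential_critical:
  assumes "x \<noteq> 0" "y \<noteq> 0" "z \<noteq> 0" "x \<noteq> 1" "y \<noteq> 1" "z \<noteq> 1"
    and C: "x + y + z + (x * y + y * z + z * x) = 2 * (x * y * z) + 2"
    and T: "(t$0)^2 = - ((x * y * z)^3) * (t$2)^2" "(t$1)^2 = ((x - 1) * (y - 1) * (z - 1))^3 * (t$2)^2"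
  shows "((\<lambda>w. potential i t w y z) has_field_derivative 0) (at x)"
proof -
  define S where "S = (t$2)^2"
  define b where "b = (y - 1) * (z - 1)"
  define p where "p = y * z"
  define s where "s = y + z"
  have b: "b = p - s + 1" by (simp add: b_def p_def s_def algebra_simps)
  have nz: "b \<noteq> 0" "p \<noteq> 0" using assms by (auto simp: b_def p_def)
  have T: "(t$0)^2 = - ((x * p)^3) * S" "(t$1)^2 = ((x - 1) * b)^3 * S" "(t$2)^2 = S"
    using T by (simp_all add: S_def p_def b_def mult_ac)
  have C: "x + s + (x * s + p) = 2 * (x * p) + 2"
    using C by (simp add: s_def p_def algebra_simps)
  \<comment> \<open>The cubes in \<open>T\<close> cancel the cubed denominators of the derivatives, so only polynomials remain.\<close>
  have quot: "((\<lambda>w. k * (f w / ((w - n) * m)^2)) has_field_derivative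
      u * m * S * (f' * (x - n) - 2 * f x)) (at x)"
    if "(f has_field_derivative f') (at x)" "x \<noteq> n" "m \<noteq> 0" "k = u * ((x - n) * m)^3 * S"
    for f f' n m k u
  proof -
    define D where "D = (x - n) * m"
    have D: "D \<noteq> 0" using that(2,3) by (simp add: D_def)
    have "((\<lambda>w. k * (f w / ((w - n) * m)^2)) has_field_derivative
       u * D^3 * S * ((f' * D^2 - f x * (2 * D * m)) / (D^2 * D^2))) (at x)"
      using D unfolding that(4) D_def
      by (auto intro!: derivative_eq_intros that(1) simp: mult_ac right_diff_distrib)
    also have "u * D^3 * S * ((f' * D^2 - f x * (2 * D * m)) / (D^2 * D^2)) = u * S * (f' * D - 2 * f x * m)"
      using D by (simp add: divide_simps power2_eq_square power3_eq_cube right_diff_distrib left_diff_distrib mult_ac)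
    finally show ?thesis
      by (simp add: D_def algebra_simps)
  qed
  consider "i = 0" | "i = 1" | "i = 2" using exhaust_3_from_0 by blast
  then show ?thesis
  proof cases
    case 1
    let ?f = "\<lambda>w. w * p * (w + s - w * p - 2)"
    have rep: "potential 0 t w y z = (t$0)^2 * (1 / w^2 + (1 / y^2 + 1 / z^2) - (2 * (w * s + p) - (w + s)) / (w * p))
        - (t$1)^2 * (?f w / ((w - 1) * b)^2) + S * (w * p * (w + s - 2))" for w
      by (simp add: potential_def Let_def s_def p_def b_def S_def algebra_simps)
    \<comment> \<open>The middle summand is an instance of \<open>quot\<close> with
      \<open>u = 1\<close>, \<open>n = 1\<close>, \<open>m = b\<close>. The \<open>t_0\<close> term
      is not a single quotient of that shape and is differentiated separately.\<close>
    have "((\<lambda>w. potential 0 t w y z) has_field_derivative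
        S * p^2 * (2 * p + x * (s - 2 * p))
        - 1 * b * S * (p * (2 * x + s - 2 * (x * p) - 2) * (x - 1) - 2 * ?f x) + S * p * (2 * x + s - 2)) (at x)"
      unfolding rep
    proof (intro DERIV_add DERIV_diff quot)
      have "((\<lambda>w. 1 / w^2 + (1 / y^2 + 1 / z^2) - (2 * (w * s + p) - (w + s)) / (w * p)) has_field_derivative
         - 2 / x^3 - (s - 2 * p) / (x^2 * p)) (at x)"
        using nz assms(1)
        by (auto intro!: derivative_eq_intros) (simp add: divide_simps, algebra)
      from DERIV_cmult[OF this, of "(t$0)^2"]
      show "((\<lambda>w. (t$0)^2 * (1 / w^2 + (1 / y^2 + 1 / z^2) - (2 * (w * s + p) - (w + s)) / (w * p)))
         has_field_derivative S * p^2 * (2 * p + x * (s - 2 * p))) (at x)"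
        unfolding T by (rule DERIV_cong) (simp add: nz assms(1) divide_simps, algebra)
    qed (auto intro!: derivative_eq_intros simp: T assms nz algebra_simps)
    moreover have "S * p^2 * (2 * p + x * (s - 2 * p))
        - 1 * b * S * (p * (2 * x + s - 2 * (x * p) - 2) * (x - 1) - 2 * ?f x) + S * p * (2 * x + s - 2) = 0"
      using C b by algebra
    ultimately show ?thesis by (simp add: 1)
  next
    case 2
    let ?d = "\<lambda>w. (w - 1) * b"
    let ?f = "\<lambda>w. ?d w * (?d w - (w + s) + 1)"
    \<comment> \<open>Here the \<open>t_0\<close> term fits \<open>quot\<close> with
      \<open>u = -1\<close>, \<open>n = 0\<close>, \<open>m = p\<close>, hence the
      \<open>w - 0\<close>; the \<open>t_1\<close> term is the one treated separately.\<close>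
    have rep: "potential 1 t w y z = (t$0)^2 * (?f w / ((w - 0) * p)^2)
        + (t$1)^2 * (1 / (w - 1)^2 + (1 / (y - 1)^2 + 1 / (z - 1)^2) + (2 * (w * s + p) - 3 * (w + s) + 3) / ?d w)
        + S * (?d w * (w + s - 1))" for w
      by (simp add: potential_def Let_def s_def p_def b_def S_def algebra_simps)
    have "((\<lambda>w. potential 1 t w y z) has_field_derivative
        (- 1) * p * S * (b * (2 * ?d x - 2 * x - s + 2) * (x - 0) - 2 * ?f x)
        + - (S * b^2 * (2 * b + (x - 1) * (2 * p - s)))
        + S * b * (2 * x + s - 2)) (at x)"
      unfolding rep
    proof (intro DERIV_add DERIV_diff quot)
      have "((\<lambda>w. 1 / (w - 1)^2 + (1 / (y - 1)^2 + 1 / (z - 1)^2)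
           + (2 * (w * s + p) - 3 * (w + s) + 3) / ?d w)
         has_field_derivative - 2 / (x - 1)^3 - (2 * p - s) / ((x - 1)^2 * b)) (at x)"
        using nz assms(4)
        by (auto intro!: derivative_eq_intros) (simp add: divide_simps, algebra)
      from DERIV_cmult[OF this, of "(t$1)^2"]
      show "((\<lambda>w. (t$1)^2 * (1 / (w - 1)^2 + (1 / (y - 1)^2 + 1 / (z - 1)^2)
           + (2 * (w * s + p) - 3 * (w + s) + 3) / ?d w))
         has_field_derivative - (S * b^2 * (2 * b + (x - 1) * (2 * p - s)))) (at x)"
        unfolding T by (rule DERIV_cong) (simp add: nz assms(4) divide_simps, algebra)
    qed (auto intro!: derivative_eq_intros simp: T assms nz algebra_simps)
    moreover have "(- 1) * p * S * (b * (2 * ?d x - 2 * x - s + 2) * (x - 0) - 2 * ?f x)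
        + - (S * b^2 * (2 * b + (x - 1) * (2 * p - s)))
        + S * b * (2 * x + s - 2) = 0"
      using C b by algebra
    ultimately show ?thesis by (simp add: 2)
  next
    case 3
    have "potential 2 t w y z = S * ((w + s)^2 - 2 * (w + s) - (w * s + p) + 1)
       - (t$0)^2 * ((2 * (w * p) - (w * s + p)) / ((w - 0) * p)^2)
       + (t$1)^2 * ((2 * (w * p) - (w * s + p) + 1) / ((w - 1) * b)^2)" for w
      by (simp add: potential_def Let_def s_def p_def b_def S_def algebra_simps)
    moreover have "((\<lambda>w. S * ((w + s)^2 - 2 * (w + s) - (w * s + p) + 1)
       - (t$0)^2 * ((2 * (w * p) - (w * s + p)) / ((w - 0) * p)^2)
       + (t$1)^2 * ((2 * (w * p) - (w * s + p) + 1) / ((w - 1) * b)^2))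
       has_field_derivative S * (2 * (x + s) - 2 - s)
         - (-1) * p * S * ((2 * p - s) * (x - 0) - 2 * (2 * (x * p) - (x * s + p)))
         + 1 * b * S * ((2 * p - s) * (x - 1) - 2 * (2 * (x * p) - (x * s + p) + 1))) (at x)"
      by (intro DERIV_add DERIV_diff quot)
        (auto intro!: derivative_eq_intros simp: T assms nz algebra_simps)
    moreover have "S * (2 * (x + s) - 2 - s)
         - (-1) * p * S * ((2 * p - s) * (x - 0) - 2 * (2 * (x * p) - (x * s + p)))
         + 1 * b * S * ((2 * p - s) * (x - 1) - 2 * (2 * (x * p) - (x * s + p) + 1)) = 0"
      using C b by algebra
    ultimately show ?thesis by (simp add: 3)
  qed
qed

section \<open>Partial derivatives of the Hamiltonians\<close>

text \<open>Arithmetic on indices is modulo 3, so \<open>j, j + 1, j + 2\<close> is a rotation of \<open>1, 2, 3\<close>.\<close>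

lemma H_decomposition_at:
  assumes "\<And>i. t $ i \<noteq> 0" and "\<And>j. q $ j \<noteq> 1" and "\<And>j. q $ j \<noteq> 0"
  shows "H i t q \<eta> = (kinetic i (q$j) (q$(j+1)) (q$(j+2)) (\<eta>$j) (\<eta>$(j+1)) (\<eta>$(j+2))
       + 4 * potential i t (q$j) (q$(j+1)) (q$(j+2))) / t$i
       + (if i = 2 then - 1 / (36 * t$2) else (144 * (t$i)^2 - 13) / (36 * t$i))"
proof -
  have num: "(4::3) = 1" "(5::3) = 2" by simp_all
  show ?thesis
    using exhaust_3[of j] H_decomposition[OF assms, of i \<eta>]
    by (auto simp: num kinetic_rotate[of i "q$3" "q$1"] potential_rotate[of i t "q$3" "q$1"]
      kinetic_rotate[of i "q$2" "q$3"] potential_rotate[of i t "q$2" "q$3"])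
qed

text \<open>The potential contributes to neither derivative: it does not contain the momenta and is
  critical in the positions. Both derivatives are thus governed by the same number
  \<open>v\<close>.\<close>

lemma H_partial_derivs:
  assumes t: "\<And>i. t $ i \<noteq> 0" and q: "\<And>j. q $ j \<noteq> 0" "\<And>j. q $ j \<noteq> 1"
    and d: "\<And>j k. j \<noteq> k \<Longrightarrow> q $ j \<noteq> q $ k"
    and \<eta>: "\<And>j. \<eta> $ j = \<eta>_graph (q $ j)"
    and xyz: "x = q $ j" "y = q $ (j + 1)" "z = q $ (j + 2)"
    and C: "x + y + z + (x * y + y * z + z * x) = 2 * (x * y * z) + 2"
    and T: "(t$0)^2 = - ((x * y * z)^3) * (t$2)^2" "(t$1)^2 = ((x - 1) * (y - 1) * (z - 1))^3 * (t$2)^2"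
    and v: "v = - prefactor i x y z * ((2 * quad_coeff i x * \<eta>_graph x - lin_coeff i x) / ((x - y) * (x - z))) / t $ i"
  shows "((\<lambda>a. H i t q (subst_coord \<eta> j a)) has_field_derivative v) (at (\<eta> $ j))"
    and "((\<lambda>w. H i t (subst_coord q j w) \<eta>) has_field_derivative
       (1 / (3 * x^2) + 1 / (3 * (x - 1)^2)) * v) (at (q $ j))"
proof -
  define c where "c = (if i = 2 then - 1 / (36 * t$2) else (144 * (t$i)^2 - 13) / (36 * t$i))"
  have sub: "subst_coord r j w $ j = w" "subst_coord r j w $ (j + 1) = r $ (j + 1)"
     "subst_coord r j w $ (j + 2) = r $ (j + 2)" for r w
    by (simp_all add: subst_coord_def)
  have ne: "x \<noteq> y" "y \<noteq> z" "z \<noteq> x"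
    unfolding xyz by (intro d; simp)+
  have nz: "x \<noteq> 0" "y \<noteq> 0" "z \<noteq> 0" "x \<noteq> 1" "y \<noteq> 1" "z \<noteq> 1"
    using q by (simp_all add: xyz)
  note dec = H_decomposition_at[of t _ i _ j, folded c_def]
  note kin = kinetic_momentum_deriv[of i x y z "\<eta>_graph y" "\<eta>_graph z" "\<eta>_graph x"]
  have "H i t q (subst_coord \<eta> j a) = (kinetic i x y z a (\<eta>_graph y) (\<eta>_graph z)
       + 4 * potential i t x y z) / t$i + c" for a
    by (subst dec[OF t q(2) q(1)]) (simp add: sub \<eta> xyz)
  then show "((\<lambda>a. H i t q (subst_coord \<eta> j a)) has_field_derivative v) (at (\<eta> $ j))"
    unfolding \<eta> xyz(1)[symmetric] by (auto intro!: derivative_eq_intros kin simp: v t)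
  \<comment> \<open>The decomposition applies at the displaced point while the moved coordinate
    avoids 0 and 1; equality near \<open>x\<close> suffices for the derivative.\<close>
  have "\<forall>\<^sub>F w in nhds x. w \<in> - {0, 1}"
    using nz by (intro eventually_nhds_in_open) (auto intro: finite_imp_closed)
  then have ev: "\<forall>\<^sub>F w in nhds x. H i t (subst_coord q j w) \<eta> =
     (kinetic i w y z (\<eta>_graph x) (\<eta>_graph y) (\<eta>_graph z) + 4 * potential i t w y z) / t$i + c"
  proof eventually_elim
    case (elim w)
    then have "subst_coord q j w $ k \<noteq> 0" "subst_coord q j w $ k \<noteq> 1" for k
      using q by (auto simp: subst_coord_def)
    then show ?case
      by (subst dec[OF t]) (simp_all add: sub \<eta> xyz)
  qed
  have "((\<lambda>w. (kinetic i w y z (\<eta>_graph x) (\<eta>_graph y) (\<eta>_graph z) + 4 * potential i t w y z) / t$i + c)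
     has_field_derivative (1 / (3 * x^2) + 1 / (3 * (x - 1)^2)) * v) (at x)"
    by (auto intro!: derivative_eq_intros kinetic_position_deriv[OF ne nz kin] potential_critical[OF nz C T]
       simp: v t)
  then show "((\<lambda>w. H i t (subst_coord q j w) \<eta>) has_field_derivative
       (1 / (3 * x^2) + 1 / (3 * (x - 1)^2)) * v) (at (q $ j))"
    using DERIV_cong_ev[OF refl ev refl] by (simp add: xyz)
qed

section \<open>The roots of the cubic and their dependence on \<open>t\<close>\<close>

lemma eventually_subst_coord:
  fixes U :: "('a::topological_space^'n) set"
  assumes "open U" "x \<in> U"
  shows "\<forall>\<^sub>F z in nhds (x $ i). subst_coord x i z \<in> U"
proof -
  have "((\<lambda>z. subst_coord x i z $ k) \<longlongrightarrow> x $ k) (nhds (x $ i))" for k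
    by (cases "k = i") (auto simp: subst_coord_def filterlim_ident)
  then have "(subst_coord x i \<longlongrightarrow> x) (nhds (x $ i))"
    by (rule vec_tendstoI)
  then show ?thesis using assms by (rule topological_tendstoD)
qed

lemma subst_coord_self [simp]: "subst_coord x i (x $ i) = x"
  by (simp add: subst_coord_def vec_eq_iff)

text \<open>Vieta's formulas by divided differences: subtracting the equations of two distinct roots
  and cancelling the difference of the roots lowers the degree, and doing so twice isolates
  \<open>x + y + z\<close>.\<close>

lemma cubic_vieta:
  fixes x y z s\<^sub>0 s\<^sub>1 s\<^sub>2 :: complex
  assumes "x \<noteq> y" "y \<noteq> z" "z \<noteq> x" "s\<^sub>2 \<noteq> 0"
    and root: "\<forall>w\<in>{x, y, z}. s\<^sub>0 * ((w - 1) * (w - 2)) - s\<^sub>1 * (w * (w + 1)) + s\<^sub>2 * (w * (w - 1) * (2 * w - 1)) = 0"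
  shows "s\<^sub>0 = - (x * y * z) * s\<^sub>2" "s\<^sub>1 = (x - 1) * (y - 1) * (z - 1) * s\<^sub>2"
    "x + y + z + (x * y + y * z + z * x) = 2 * (x * y * z) + 2"
proof -
  have r: "s\<^sub>0 * ((w - 1) * (w - 2)) - s\<^sub>1 * (w * (w + 1)) + s\<^sub>2 * (w * (w - 1) * (2 * w - 1)) = 0"
    if "w = x \<or> w = y \<or> w = z" for w
    using root that by blast
  have "(x - y) * (2 * s\<^sub>2 * (x^2 + x * y + y^2) + (s\<^sub>0 - s\<^sub>1 - 3 * s\<^sub>2) * (x + y) + (s\<^sub>2 - 3 * s\<^sub>0 - s\<^sub>1)) = 0"
    using r[of x] r[of y] by simp algebra
  then have xy: "2 * s\<^sub>2 * (x^2 + x * y + y^2) + (s\<^sub>0 - s\<^sub>1 - 3 * s\<^sub>2) * (x + y) + (s\<^sub>2 - 3 * s\<^sub>0 - s\<^sub>1) = 0"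
    using assms(1) by simp
  have "(z - y) * (2 * s\<^sub>2 * (z^2 + z * y + y^2) + (s\<^sub>0 - s\<^sub>1 - 3 * s\<^sub>2) * (z + y) + (s\<^sub>2 - 3 * s\<^sub>0 - s\<^sub>1)) = 0"
    using r[of z] r[of y] by simp algebra
  then have zy: "2 * s\<^sub>2 * (z^2 + z * y + y^2) + (s\<^sub>0 - s\<^sub>1 - 3 * s\<^sub>2) * (z + y) + (s\<^sub>2 - 3 * s\<^sub>0 - s\<^sub>1) = 0"
    using assms(2) by simp
  have "(x - z) * (2 * s\<^sub>2 * (x + y + z) + (s\<^sub>0 - s\<^sub>1 - 3 * s\<^sub>2)) = 0"
    using xy zy by algebra
  then have e1: "2 * s\<^sub>2 * (x + y + z) + (s\<^sub>0 - s\<^sub>1 - 3 * s\<^sub>2) = 0"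
    using assms(3) by simp
  have e2: "2 * s\<^sub>2 * (x * y + y * z + z * x) = s\<^sub>2 - 3 * s\<^sub>0 - s\<^sub>1"
    using e1 xy by algebra
  have "2 * s\<^sub>0 = 2 * (- (x * y * z) * s\<^sub>2)"
    using e1 e2 r[of x] by simp algebra
  then show s0: "s\<^sub>0 = - (x * y * z) * s\<^sub>2" by simp
  have "2 * s\<^sub>1 = 2 * ((x - 1) * (y - 1) * (z - 1) * s\<^sub>2)"
    using e1 e2 s0 by algebra
  then show s1: "s\<^sub>1 = (x - 1) * (y - 1) * (z - 1) * s\<^sub>2" by simp
  \<comment> \<open>This is \<open>e1\<close> with \<open>s\<^sub>0\<close> and
    \<open>s\<^sub>1\<close> eliminated.\<close>
  have "s\<^sub>2 * (x + y + z + (x * y + y * z + z * x)) = s\<^sub>2 * (2 * (x * y * z) + 2)"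
    using e1 s0 s1 by algebra
  then show "x + y + z + (x * y + y * z + z * x) = 2 * (x * y * z) + 2"
    using assms(4) by simp
qed

lemma root_velocity:
  fixes s\<^sub>0 s\<^sub>1 s\<^sub>2 X :: "complex \<Rightarrow> complex"
  assumes d: "(s\<^sub>0 has_field_derivative s\<^sub>0') (at \<tau>)" "(s\<^sub>1 has_field_derivative s\<^sub>1') (at \<tau>)"
      "(s\<^sub>2 has_field_derivative s\<^sub>2') (at \<tau>)" "(X has_field_derivative X') (at \<tau>)"
    and ev: "\<forall>\<^sub>F u in nhds \<tau>. s\<^sub>0 u * ((X u - 1) * (X u - 2)) - s\<^sub>1 u * (X u * (X u + 1))
       + s\<^sub>2 u * (X u * (X u - 1) * (2 * X u - 1)) = 0"
  shows "s\<^sub>0' * ((X \<tau> - 1) * (X \<tau> - 2)) - s\<^sub>1' * (X \<tau> * (X \<tau> + 1)) + s\<^sub>2' * (X \<tau> * (X \<tau> - 1) * (2 * X \<tau> - 1))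
     + X' * (s\<^sub>0 \<tau> * (2 * X \<tau> - 3) - s\<^sub>1 \<tau> * (2 * X \<tau> + 1) + s\<^sub>2 \<tau> * (6 * (X \<tau>)^2 - 6 * X \<tau> + 1)) = 0"
proof -
  let ?F = "\<lambda>u. s\<^sub>0 u * ((X u - 1) * (X u - 2)) - s\<^sub>1 u * (X u * (X u + 1))
       + s\<^sub>2 u * (X u * (X u - 1) * (2 * X u - 1))"
  have "(?F has_field_derivative s\<^sub>0' * ((X \<tau> - 1) * (X \<tau> - 2)) - s\<^sub>1' * (X \<tau> * (X \<tau> + 1)) + s\<^sub>2' * (X \<tau> * (X \<tau> - 1) * (2 * X \<tau> - 1))
     + X' * (s\<^sub>0 \<tau> * (2 * X \<tau> - 3) - s\<^sub>1 \<tau> * (2 * X \<tau> + 1) + s\<^sub>2 \<tau> * (6 * (X \<tau>)^2 - 6 * X \<tau> + 1))) (at \<tau>)"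
    by (auto intro!: derivative_eq_intros d simp: algebra_simps power2_eq_square)
  moreover have "(?F has_field_derivative 0) (at \<tau>)"
    using DERIV_cong_ev[OF refl ev refl] by simp
  ultimately show ?thesis by (rule DERIV_unique)
qed

lemma has_field_derivative_cong_subst_coord:
  fixes f g :: "complex^'n \<Rightarrow> complex"
  assumes "open U" "t \<in> U" "\<And>u. u \<in> U \<Longrightarrow> f u = g u"
    and "((\<lambda>w. f (subst_coord t i w)) has_field_derivative D) (at (t $ i))"
  shows "((\<lambda>w. g (subst_coord t i w)) has_field_derivative D) (at (t $ i))"
proof -
  have "\<forall>\<^sub>F w in nhds (t $ i). f (subst_coord t i w) = g (subst_coord t i w)"
    using eventually_subst_coord[OF assms(1,2)] by eventually_elim (rule assms(3))
  from DERIV_cong_ev[OF refl this refl] assms(4) show ?thesis by simp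
qed

text \<open>Differentiating \<open>s^3 = t_k^2\<close> gives \<open>3 s^2\<close> times the
  derivative. Multiplying by \<open>t_k\<close> and using the relation again yields a value linear
  in \<open>s\<close>, to which the Vieta relations apply.\<close>

lemma cube_root_partial_deriv:
  fixes s :: "complex^'n \<Rightarrow> complex"
  assumes "open U" "t \<in> U" "s holomorphic_multi_on U" "s t \<noteq> 0" "\<And>u. u \<in> U \<Longrightarrow> (u $ k)^2 = (s u)^3"
  shows "partial_deriv i s t = (if k = i then 2 * s t / (3 * t $ k) else 0)"
proof -
  have ne: "t $ k \<noteq> 0"
    using assms(2,4,5) by (metis power_not_zero zero_power2)
  have "((\<lambda>w. (s (subst_coord t i w))^3) has_field_derivative 3 * (s t)^2 * partial_deriv i s t) (at (t $ i))"
    using holomorphic_multi_on_has_partial_deriv[OF assms(3,2), of i]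
    by (auto intro!: derivative_eq_intros)
  moreover have "((\<lambda>w. (s (subst_coord t i w))^3) has_field_derivative (if k = i then 2 * t $ k else 0)) (at (t $ i))"
    by (rule has_field_derivative_cong_subst_coord[OF assms(1,2,5)])
      (auto simp: subst_coord_def intro!: derivative_eq_intros)
  ultimately have "3 * (s t)^2 * partial_deriv i s t = (if k = i then 2 * t $ k else 0)"
    by (rule DERIV_unique)
  moreover have "(t $ k)^2 = (s t)^3" using assms by blast
  ultimately show ?thesis
  proof (cases "k = i")
    case True
    with \<open>3 * (s t)^2 * partial_deriv i s t = _\<close> have "3 * (s t)^2 * partial_deriv i s t = 2 * t $ k"
      by simp
    with \<open>(t $ k)^2 = (s t)^3\<close> have "(s t)^2 * (partial_deriv i s t * (3 * t $ k)) = (s t)^2 * (2 * s t)"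
      by algebra
    then show ?thesis using True ne assms(4) by (simp add: divide_simps)
  qed (use assms(4) in simp)
qed

section \<open>Hamilton's equations along the roots\<close>

theorem theorem1p1:
  fixes U :: "(complex^3) set"
    and s q \<eta> :: "complex^3 \<Rightarrow> complex^3"
  assumes "open U" and "connected U"
    and "\<And>t i. t \<in> U \<Longrightarrow> t $ i \<noteq> 0"
    and "\<And>i. (\<lambda>t. s t $ i) holomorphic_multi_on U"
    and "\<And>t i. t \<in> U \<Longrightarrow> s t $ i \<noteq> 0"
    and "\<And>t i. t \<in> U \<Longrightarrow> (t $ i)^2 = (s t $ i)^3"
    and "\<And>j. (\<lambda>t. q t $ j) holomorphic_multi_on U"
    and "\<And>t j k. t \<in> U \<Longrightarrow> j \<noteq> k \<Longrightarrow> q t $ j \<noteq> q t $ k"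
    and "\<And>t j. t \<in> U \<Longrightarrow> q t $ j \<noteq> 0"
    and "\<And>t j. t \<in> U \<Longrightarrow> q t $ j \<noteq> 1"
    and "\<And>t j. t \<in> U \<Longrightarrow>
           (q t $ j)^3
           + (s t $ 0 - s t $ 1 - 3 * s t $ 2) / (2 * s t $ 2) * (q t $ j)^2
           + (- 3 * s t $ 0 - s t $ 1 + s t $ 2) / (2 * s t $ 2) * q t $ j
           + s t $ 0 / s t $ 2 = 0"
    and "\<And>t j. t \<in> U \<Longrightarrow> \<eta> t $ j = 1 / (3 * q t $ j) + 1 / (3 * (q t $ j - 1))"
  shows "\<forall>t\<in>U. \<forall>i j.
           partial_deriv i (\<lambda>t. q t $ j) t = partial_deriv j (\<lambda>e. H i t (q t) e) (\<eta> t) \<and>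
           partial_deriv i (\<lambda>t. \<eta> t $ j) t = - partial_deriv j (\<lambda>x. H i t x (\<eta> t)) (q t)"
proof (intro ballI allI)
  fix t i j
  assume t: "t \<in> U"
  define x y z where xyz: "x = q t $ j" "y = q t $ (j + 1)" "z = q t $ (j + 2)"
  have ne: "x \<noteq> y" "y \<noteq> z" "z \<noteq> x"
    unfolding xyz by (intro assms(8)[OF t]; simp)+
  have nz: "x \<noteq> 0" "x \<noteq> 1"
    unfolding xyz using assms(9,10)[OF t] by auto
  have \<eta>: "\<eta> u $ k = \<eta>_graph (q u $ k)" if "u \<in> U" for u k
    using assms(12)[OF that] by (simp add: \<eta>_graph_def)
  have cubic: "s u $ 0 * ((q u $ k - 1) * (q u $ k - 2)) - s u $ 1 * (q u $ k * (q u $ k + 1))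
      + s u $ 2 * (q u $ k * (q u $ k - 1) * (2 * q u $ k - 1)) = 0" if "u \<in> U" for u k
  proof -
    have "s u $ 0 * ((q u $ k - 1) * (q u $ k - 2)) - s u $ 1 * (q u $ k * (q u $ k + 1))
      + s u $ 2 * (q u $ k * (q u $ k - 1) * (2 * q u $ k - 1))
      = 2 * s u $ 2 * ((q u $ k)^3
           + (s u $ 0 - s u $ 1 - 3 * s u $ 2) / (2 * s u $ 2) * (q u $ k)^2
           + (- 3 * s u $ 0 - s u $ 1 + s u $ 2) / (2 * s u $ 2) * q u $ k
           + s u $ 0 / s u $ 2)"
      using assms(5)[OF that, of 2] by (simp add: divide_simps) algebra
    then show ?thesis using assms(11)[OF that, of k] by simp
  qed
  have "\<forall>w\<in>{x, y, z}. s t $ 0 * ((w - 1) * (w - 2)) - s t $ 1 * (w * (w + 1))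
      + s t $ 2 * (w * (w - 1) * (2 * w - 1)) = 0"
    using cubic[OF t] by (auto simp: xyz)
  note vieta = cubic_vieta[OF ne assms(5)[OF t] this]
  define X' where "X' = partial_deriv i (\<lambda>t. q t $ j) t"
  have dX: "((\<lambda>w. q (subst_coord t i w) $ j) has_field_derivative X') (at (t $ i))"
    unfolding X'_def by (rule holomorphic_multi_on_has_partial_deriv[OF assms(7) t])
  have ds: "((\<lambda>w. s (subst_coord t i w) $ k) has_field_derivative
      (if k = i then 2 * s t $ k / (3 * t $ k) else 0)) (at (t $ i))" for k
    using holomorphic_multi_on_has_partial_deriv[OF assms(4)[of k] t, of i]
      cube_root_partial_deriv[OF assms(1) t assms(4) assms(5)[OF t] assms(6), of i k]
    by simp
  have "(if 0 = i then 2 * s t $ 0 / (3 * t $ 0) else 0) * ((x - 1) * (x - 2))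
     - (if 1 = i then 2 * s t $ 1 / (3 * t $ 1) else 0) * (x * (x + 1))
     + (if 2 = i then 2 * s t $ 2 / (3 * t $ 2) else 0) * (x * (x - 1) * (2 * x - 1))
     + X' * (s t $ 0 * (2 * x - 3) - s t $ 1 * (2 * x + 1) + s t $ 2 * (6 * x^2 - 6 * x + 1)) = 0"
    using root_velocity[OF ds[of 0] ds[of 1] ds[of 2] dX] eventually_subst_coord[OF assms(1) t, of i]
    by (simp add: eventually_mono cubic xyz(1))
  \<comment> \<open>Both sides are the derivative at \<open>w = x\<close> of
    \<open>2 s_2 (w - x)(w - y)(w - z)\<close>, which is nonzero because the roots are
    distinct.\<close>
  also have "s t $ 0 * (2 * x - 3) - s t $ 1 * (2 * x + 1) + s t $ 2 * (6 * x^2 - 6 * x + 1)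
      = 2 * s t $ 2 * ((x - y) * (x - z))"
    using vieta by algebra
  finally have vel: "(if 0 = i then 2 * s t $ 0 / (3 * t $ 0) else 0) * ((x - 1) * (x - 2))
     - (if 1 = i then 2 * s t $ 1 / (3 * t $ 1) else 0) * (x * (x + 1))
     + (if 2 = i then 2 * s t $ 2 / (3 * t $ 2) else 0) * (x * (x - 1) * (2 * x - 1))
     + X' * (2 * s t $ 2 * ((x - y) * (x - z))) = 0" .
  define v where "v = - prefactor i x y z *
     ((2 * quad_coeff i x * \<eta>_graph x - lin_coeff i x) / ((x - y) * (x - z))) / t $ i"
  have W: "(x - y) * (x - z) \<noteq> 0" "s t $ 2 \<noteq> 0" "t $ i \<noteq> 0"
    using ne assms(3,5)[OF t] by auto
  have v: "v = (if i = 0 then x * y * z * ((x - 1) * (x - 2)) else if i = 1 then (x - 1) * (y - 1) * (z - 1) * (x * (x + 1))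
     else - (x * (x - 1) * (2 * x - 1))) / (3 * ((x - y) * (x - z)) * t $ i)"
    unfolding v_def momentum_coeff_on_graph[OF nz] prefactor_def by simp
  \<comment> \<open>Only the summand of index \<open>i\<close> survives in \<open>vel\<close>:
    \<open>r\<close> is \<open>s_i\<close>, \<open>A\<close> is its polynomial, and
    \<open>r = - g * s_2\<close> is the Vieta relation, so \<open>s_2\<close> cancels.\<close>
  have solve: "X' = g * A / (3 * ((x - y) * (x - z)) * t $ i)"
    if "2 * r / (3 * t $ i) * A + X' * (2 * s t $ 2 * ((x - y) * (x - z))) = 0" "r = - g * s t $ 2" for r g A
  proof -
    define V where "V = (x - y) * (x - z)"
    have "s t $ 2 * (X' * (3 * V * t $ i)) = s t $ 2 * (g * A)"
      using that W(3) unfolding V_def[symmetric] by (simp add: divide_simps) algebra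
    then show ?thesis
      using W unfolding V_def[symmetric] by (simp add: divide_simps)
  qed
  consider "i = 0" | "i = 1" | "i = 2" using exhaust_3_from_0 by blast
  then have X': "X' = v"
  proof cases
    case 1
    show ?thesis
      unfolding v using solve[of "s t $ 0" "(x - 1) * (x - 2)" "x * y * z"] vel vieta(1) by (simp add: 1)
  next
    case 2
    show ?thesis
      unfolding v using solve[of "s t $ 1" "- (x * (x + 1))" "- ((x - 1) * (y - 1) * (z - 1))"] vel vieta(2)
      by (simp add: 2)
  next
    case 3
    show ?thesis
      unfolding v using solve[of "s t $ 2" "x * (x - 1) * (2 * x - 1)" "- 1"] vel by (simp add: 3)
  qed
  have T: "(t$0)^2 = - ((x * y * z)^3) * (t$2)^2" "(t$1)^2 = ((x - 1) * (y - 1) * (z - 1))^3 * (t$2)^2"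
    unfolding assms(6)[OF t] unfolding vieta(1,2) by (simp_all add: power_mult_distrib)
  note H = H_partial_derivs[OF assms(3)[OF t] assms(9,10)[OF t] assms(8)[OF t] \<eta>[OF t] xyz vieta(3) T v_def]
  \<comment> \<open>By the chain rule the momentum moves with minus the factor from \<open>H\<close>
    times \<open>X'\<close>; since \<open>X' = v\<close>, this is minus the position derivative of
    \<open>H i\<close>.\<close>
  have "((\<lambda>w. \<eta>_graph (q (subst_coord t i w) $ j)) has_field_derivative
      - ((1 / (3 * x^2) + 1 / (3 * (x - 1)^2)) * X')) (at (t $ i))"
    using DERIV_chain2[OF _ dX, of \<eta>_graph] \<eta>_graph_deriv[OF nz]
    unfolding mult_minus_left[symmetric] by (simp add: xyz(1))
  then have "((\<lambda>w. \<eta> (subst_coord t i w) $ j) has_field_derivative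
      - ((1 / (3 * x^2) + 1 / (3 * (x - 1)^2)) * X')) (at (t $ i))"
    using has_field_derivative_cong_subst_coord[OF assms(1) t,
      of "\<lambda>u. \<eta>_graph (q u $ j)" "\<lambda>u. \<eta> u $ j"] \<eta> by simp
  then show "partial_deriv i (\<lambda>t. q t $ j) t = partial_deriv j (\<lambda>e. H i t (q t) e) (\<eta> t) \<and>
           partial_deriv i (\<lambda>t. \<eta> t $ j) t = - partial_deriv j (\<lambda>x. H i t x (\<eta> t)) (q t)"
    using H[THEN DERIV_imp_deriv] dX[THEN DERIV_imp_deriv] X'
    by (simp add: partial_deriv_def DERIV_imp_deriv)
qed

end
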